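(* Let $S\neq\mathbb{N}$ be a numerical semigroup with type $t=t(S)$. If $I$ is an almost canonical ideal of $S$, then $t(I)\le t+1$. Moreover, for every integer $i$ such that $1\le i\le t+1$, there are exactly $\binom{t}{i-1}$ almost canonical ideals of $S$ with Frobenius number $F(S)$ and type $i$. In particular, there are exactly $2^t$ almost canonical ideals of $S$ with Frobenius number $F(S)$.
   Context: A numerical semigroup is a submonoid $S$ of $(\mathbb{N},+)$ (with $0\in\mathbb{N}$) such that $\mathbb{N}\setminus S$ is finite. $F(S)=\max(\mathbb{Z}\setminus S)$, $M=S\setminus\{0\}$, $K=\{x\in\mathbb{N}\mid F(S)-x\notin S\}$. For sets $X,Y\subseteq\mathbb{Z}$, $X-Y=\{z\in\mathbb{Z}\mid z+Y\subseteq X\}$. A relative ideal of $S$ is a nonempty set $I\subseteq\mathbb{Z}$ with $I+S\subseteq I$ and $z+I\subseteq S$ for some $z\in S$. For a relative ideal $I$: its Frobenius number is $F(I)=\max(\mathbb{Z}\setminus I)$; $\widetilde I=I+(F(S)-F(I))$; its type is $t(I)=|(I-M)\setminus I|$. In particular $t(S)=|(S-M)\setminus S|$. An almost canonical ideal of $S$ is a relative ideal $I$ of $S$ (not necessarily contained in $S$) such that $\widetilde I-M=K\cup\{F(S)\}$. *)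

theory Defs
  imports "HOL-Library.Set_Algebras"
begin

text \<open>
  Numerical semigroups are taken as sets of integers contained in \<^term>\<open>\<nat> :: int set\<close>, so that
  they and their relative ideals live in the same ambient group. On sets, \<open>+\<close> and \<open>+o\<close> denote the
  elementwise sum and the translate, while \<open>-\<close> is the set-theoretic difference.
\<close>

definition numerical_semigroup :: "int set \<Rightarrow> bool" where
  "numerical_semigroup S \<longleftrightarrow>
     S \<subseteq> \<nat> \<and> 0 \<in> S \<and> (\<forall>x\<in>S. \<forall>y\<in>S. x + y \<in> S) \<and> finite (\<nat> - S)"

text \<open>
  The maximum of \<^term>\<open>UNIV - X\<close>. This set is infinite for the sets of interest (it contains almost
  all negative integers), so \<^const>\<open>Max\<close> is not applicable.
\<close>

definition frobenius :: "int set \<Rightarrow> int" where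
  "frobenius X = (GREATEST z. z \<in> UNIV - X)"

definition max_ideal :: "int set \<Rightarrow> int set" where
  "max_ideal S = S - {0}"

definition std_canonical :: "int set \<Rightarrow> int set" where
  "std_canonical S = {x \<in> \<nat>. frobenius S - x \<notin> S}"

text \<open>The set usually written \<open>X - Y\<close> in ideal theory (not the set-theoretic difference).\<close>

definition colon :: "int set \<Rightarrow> int set \<Rightarrow> int set" where
  "colon X Y = {z. z +o Y \<subseteq> X}"

definition relative_ideal :: "int set \<Rightarrow> int set \<Rightarrow> bool" where
  "relative_ideal S I \<longleftrightarrow> I \<noteq> {} \<and> I + S \<subseteq> I \<and> (\<exists>z\<in>S. z +o I \<subseteq> S)"

text \<open>The translate of \<open>I\<close> that has the same Frobenius number as \<open>S\<close>.\<close>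

definition normalize_ideal :: "int set \<Rightarrow> int set \<Rightarrow> int set" where
  "normalize_ideal S I = (frobenius S - frobenius I) +o I"

text \<open>The type of \<open>I\<close> as a relative ideal of \<open>S\<close>; the type of \<open>S\<close> itself is \<open>ideal_type S S\<close>.\<close>

definition ideal_type :: "int set \<Rightarrow> int set \<Rightarrow> nat" where
  "ideal_type S I = card (colon I (max_ideal S) - I)"

definition almost_canonical_ideal :: "int set \<Rightarrow> int set \<Rightarrow> bool" where
  "almost_canonical_ideal S I \<longleftrightarrow>
     relative_ideal S I \<and>
     colon (normalize_ideal S I) (max_ideal S) = std_canonical S \<union> {frobenius S}"

end

theory Submission
  imports Defs
begin

text \<open>
  Write \<open>F\<close>, \<open>M\<close>, \<open>K\<close> for the Frobenius number, the maximal ideal and the standard canonical ideal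
  of \<open>S\<close>. The key point is that the almost canonical ideals of \<open>S\<close> with Frobenius number \<open>F\<close> are
  exactly the sets \<open>I\<close> with \<open>M + K \<subseteq> I \<subseteq> K\<close> (lemma \<open>almost_canonical_iff_between\<close>). In one direction,
  \<open>I \<subseteq> I - M = K \<union> {F}\<close> and \<open>F \<notin> I\<close> give \<open>I \<subseteq> K\<close>, while \<open>M + K \<subseteq> I\<close> says that \<open>K \<subseteq> I - M\<close>. In the
  other direction, \<open>I - M\<close> is squeezed between \<open>K \<union> {F}\<close> (everything beyond \<open>F\<close>, in particular
  \<open>F + M\<close>, lies in \<open>M + K\<close>) and \<open>K - M\<close>, and these agree by the duality \<open>x \<in> K \<longleftrightarrow> F - x \<notin> S\<close>.

  Such an \<open>I\<close> is therefore determined by the subset \<open>K \<setminus> I\<close> of \<open>K \<setminus> (M + K)\<close>, which can be arbitrary,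
  and its type is \<open>|(K \<union> {F}) \<setminus> I| = |K \<setminus> I| + 1\<close>. The reflection \<open>x \<mapsto> F - x\<close> maps \<open>K \<setminus> (M + K)\<close>
  bijectively onto \<open>(S - M) \<setminus> S\<close>, so there are \<open>t\<close> elements to choose from, and the counts are the
  numbers of subsets of a \<open>t\<close>-element set. The bound on the type of an arbitrary almost canonical
  ideal follows because the type is invariant under translation.
\<close>

section \<open>Colons, translates and Frobenius numbers of sets of integers\<close>

lemma mem_colon_iff: "z \<in> colon X Y \<longleftrightarrow> (\<forall>y\<in>Y. z + y \<in> X)"
  by (auto simp: colon_def elt_set_plus_def)

lemma int_mem_Nats_iff: "x \<in> \<nat> \<longleftrightarrow> 0 \<le> x" for x :: int
  by (metis Nats_cases of_nat_0_le_iff of_nat_in_Nats nonneg_int_cases)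

lemma mem_translate_iff: "x \<in> a +o X \<longleftrightarrow> x - a \<in> X" for a :: int
  by (auto simp: elt_set_plus_def intro: bexI[of _ "x - a"])

lemma colon_translate: "colon (a +o X) Y = a +o colon X Y"
  by (auto simp: mem_colon_iff mem_translate_iff algebra_simps)

lemma ideal_type_translate: "ideal_type S (a +o I) = ideal_type S I"
proof -
  have "colon (a +o I) (max_ideal S) - (a +o I) = (+) a ` (colon I (max_ideal S) - I)"
    unfolding colon_translate by (auto simp: mem_translate_iff intro: image_eqI[of _ _ "_ - a"])
  then show ?thesis
    unfolding ideal_type_def by (simp add: card_image)
qed

lemma frobenius_eqI:
  assumes "f \<notin> X" and "\<And>z. f < z \<Longrightarrow> z \<in> X"
  shows "frobenius X = f"
  unfolding frobenius_def
proof (rule Greatest_equality)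
  show "y \<le> f" if "y \<in> UNIV - X" for y
    using assms(2)[of y] that by force
qed (use assms(1) in simp)

text \<open>
  The greatest element of an arbitrary set of integers need not exist. For \<open>X\<close> bounded below and
  containing all large integers it can be found in the finite window \<open>{a - 1..b}\<close>; the point
  \<open>a - 1\<close> guarantees that the window contains a gap of \<open>X\<close>.
\<close>
lemma frobenius_props:
  assumes lower: "\<And>x. x \<in> X \<Longrightarrow> a \<le> x" and upper: "\<And>x. b \<le> x \<Longrightarrow> x \<in> X"
  shows "frobenius X \<notin> X" and "frobenius X < z \<Longrightarrow> z \<in> X"
proof -
  define G where "G = {a - 1..b} - X"
  have fin: "finite G" by (simp add: G_def)
  have "a - 1 \<notin> X" using lower by force
  moreover have "a - 1 \<le> b" using lower[of b] upper[of b] by simp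
  ultimately have mem: "a - 1 \<in> G" by (simp add: G_def)
  then have Max: "Max G \<in> G" using fin by (intro Max_in) auto
  have above: "z \<in> X" if "Max G < z" for z
  proof (rule ccontr)
    assume "z \<notin> X"
    moreover have "a - 1 \<le> z" using Max_ge[OF fin mem] that by simp
    moreover have "z \<le> b" using upper[of z] \<open>z \<notin> X\<close> by force
    ultimately have "z \<in> G" by (simp add: G_def)
    then show False using Max_ge[OF fin] that by force
  qed
  have eq: "frobenius X = Max G"
    using Max above by (intro frobenius_eqI) (auto simp: G_def)
  show "frobenius X \<notin> X" using Max eq by (simp add: G_def)
  show "frobenius X < z \<Longrightarrow> z \<in> X" using above eq by simp
qed

section \<open>Duality between a semigroup and its canonical ideal\<close>

locale proper_numerical_semigroup =
  fixes S :: "int set"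
  assumes semigroup: "numerical_semigroup S" and proper: "S \<noteq> \<nat>"
begin

abbreviation "F \<equiv> frobenius S"
abbreviation "M \<equiv> max_ideal S"
abbreviation "K \<equiv> std_canonical S"

lemma nonneg: "x \<in> S \<Longrightarrow> 0 \<le> x"
  using semigroup by (auto simp: numerical_semigroup_def int_mem_Nats_iff)

lemma zero_mem: "0 \<in> S"
  using semigroup by (simp add: numerical_semigroup_def)

lemma add_mem: "x \<in> S \<Longrightarrow> y \<in> S \<Longrightarrow> x + y \<in> S"
  using semigroup by (simp add: numerical_semigroup_def)

lemma eventually_mem: obtains b where "\<And>x. b \<le> x \<Longrightarrow> x \<in> S"
proof -
  have "finite (\<nat> - S)" using semigroup by (simp add: numerical_semigroup_def)
  then obtain b where b: "\<And>x. x \<in> \<nat> - S \<Longrightarrow> x < b"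
    using finite_nat_set_iff_bounded Max_ge by (metis less_add_one order_le_less_trans)
  have "x \<in> S" if "max 0 b \<le> x" for x
    using b[of x] that by (auto simp: int_mem_Nats_iff)
  then show ?thesis by (rule that)
qed

lemma frobenius_notin: "F \<notin> S"
  using eventually_mem frobenius_props(1)[of S 0] nonneg by metis

lemma above_frobenius: "F < x \<Longrightarrow> x \<in> S"
  using eventually_mem frobenius_props(2)[of S 0] nonneg by metis

lemma frobenius_nonneg: "0 \<le> F"
proof -
  obtain x where "x \<in> \<nat>" "x \<notin> S"
    using semigroup proper by (auto simp: numerical_semigroup_def)
  then show ?thesis using above_frobenius[of x] by (fastforce simp: int_mem_Nats_iff)
qed

text \<open>
  The duality on which all later computations rest: within all integers, \<open>K\<close> is the exact mirror
  image of the complement of \<open>S\<close>. For negative \<open>x\<close> the number \<open>F - x\<close> exceeds \<open>F\<close> and so lies in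
  \<open>S\<close>, hence the reflected complement has no negative elements.
\<close>
lemma mem_canonical_iff: "x \<in> K \<longleftrightarrow> F - x \<notin> S"
  using above_frobenius[of "F - x"] by (fastforce simp: std_canonical_def int_mem_Nats_iff)

lemma canonical_add_semigroup: "x \<in> K \<Longrightarrow> s \<in> S \<Longrightarrow> x + s \<in> K"
  using add_mem[of "F - (x + s)" s] by (auto simp: mem_canonical_iff)

lemma sum_subset_canonical: "M + K \<subseteq> K"
  using canonical_add_semigroup by (fastforce simp: set_plus_def max_ideal_def add.commute)

lemma frobenius_notin_canonical: "F \<notin> K"
  by (simp add: mem_canonical_iff zero_mem)

text \<open>As \<open>0 \<in> K\<close>, the sum contains \<open>M\<close>, and \<open>M\<close> contains everything beyond \<open>F \<ge> 0\<close>.\<close>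
lemma above_frobenius_mem_sum: "F < x \<Longrightarrow> x \<in> M + K"
proof -
  assume "F < x"
  then have "x \<in> M" using above_frobenius frobenius_nonneg by (simp add: max_ideal_def)
  moreover have "0 \<in> K" by (simp add: mem_canonical_iff frobenius_notin)
  ultimately have "x + 0 \<in> M + K" by (rule set_plus_intro)
  then show ?thesis by simp
qed

text \<open>
  By duality \<open>z + M \<subseteq> K\<close> says that \<open>F - z\<close> is not of the form \<open>s + s'\<close> with \<open>s \<in> M\<close>, \<open>s' \<in> S\<close>, that is,
  \<open>F - z \<notin> M\<close>; this leaves \<open>F - z \<notin> S\<close> or \<open>z = F\<close>.
\<close>
lemma colon_canonical: "colon K M = K \<union> {F}"
proof (intro equalityI subsetI)
  fix z assume "z \<in> colon K M"
  then have "F - z \<notin> M"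
    using zero_mem by (fastforce simp: mem_colon_iff mem_canonical_iff)
  then show "z \<in> K \<union> {F}"
    by (auto simp: mem_canonical_iff max_ideal_def)
next
  fix z assume z: "z \<in> K \<union> {F}"
  have "z + s \<in> K" if "s \<in> M" for s
  proof (cases "z = F")
    case True
    then show ?thesis
      using that nonneg[of s] nonneg[of "- s"] by (auto simp: mem_canonical_iff max_ideal_def)
  next
    case False
    then show ?thesis
      using z that canonical_add_semigroup by (simp add: max_ideal_def)
  qed
  then show "z \<in> colon K M" by (simp add: mem_colon_iff)
qed

section \<open>Translation of relative ideals\<close>

lemma relative_ideal_add: "relative_ideal S I \<Longrightarrow> x \<in> I \<Longrightarrow> s \<in> S \<Longrightarrow> x + s \<in> I"
  using set_plus_intro[of x I s S] by (auto simp only: relative_ideal_def)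

lemma relative_ideal_frobenius:
  assumes "relative_ideal S I"
  shows "frobenius I \<notin> I" and "frobenius I < z \<Longrightarrow> z \<in> I"
proof -
  obtain x s where x: "x \<in> I" and s: "s +o I \<subseteq> S"
    using assms by (auto simp: relative_ideal_def)
  obtain b where b: "\<And>y. b \<le> y \<Longrightarrow> y \<in> S" using eventually_mem by metis
  have lower: "- s \<le> y" if "y \<in> I" for y
    using s that nonneg[of "s + y"] by (auto simp: elt_set_plus_def)
  have upper: "y \<in> I" if "b + x \<le> y" for y
  proof -
    have "y - x \<in> S" using b that by simp
    then show ?thesis using relative_ideal_add[OF assms x] by fastforce
  qed
  show "frobenius I \<notin> I" "frobenius I < z \<Longrightarrow> z \<in> I"
    using frobenius_props[OF lower upper] by auto
qed

lemma relative_ideal_translate: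
  assumes "relative_ideal S I"
  shows "relative_ideal S (a +o I)"
proof -
  obtain s where s: "s +o I \<subseteq> S" using assms by (auto simp: relative_ideal_def)
  obtain b where b: "\<And>y. b \<le> y \<Longrightarrow> y \<in> S" using eventually_mem by metis
  \<comment> \<open>\<open>s - a\<close> moves \<open>a + I\<close> into \<open>S\<close> but may lie outside \<open>S\<close>; adding a large \<open>c \<in> S\<close> repairs this.\<close>
  define c where "c = max b (b - s + a)"
  have "c \<in> S" "c + s - a \<in> S" by (auto simp: c_def intro!: b)
  moreover have "(c + s - a) +o (a +o I) \<subseteq> S"
  proof
    fix y assume "y \<in> (c + s - a) +o (a +o I)"
    then have "y - c - s \<in> I" by (simp add: mem_translate_iff algebra_simps)
    then have "s + (y - c - s) \<in> S" using s by (auto simp: elt_set_plus_def)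
    then show "y \<in> S" using add_mem[OF \<open>c \<in> S\<close>, of "y - c"] by simp
  qed
  moreover have "(a +o I) + S \<subseteq> a +o I"
    using relative_ideal_add[OF assms] by (fastforce simp: set_plus_def elt_set_plus_def add.assoc)
  moreover have "a +o I \<noteq> {}"
    using assms by (auto simp: relative_ideal_def elt_set_plus_def)
  ultimately show ?thesis unfolding relative_ideal_def by blast
qed

lemma frobenius_translate:
  assumes "relative_ideal S I"
  shows "frobenius (a +o I) = a + frobenius I"
  using relative_ideal_frobenius[OF assms]
  by (intro frobenius_eqI) (auto simp: mem_translate_iff)

lemma normalize_ideal_self: "frobenius I = F \<Longrightarrow> normalize_ideal S I = I"
  by (simp add: normalize_ideal_def)

lemma frobenius_normalize_ideal:
  "relative_ideal S I \<Longrightarrow> frobenius (normalize_ideal S I) = F"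
  by (simp add: normalize_ideal_def frobenius_translate)

lemma almost_canonical_normalize_ideal:
  assumes "almost_canonical_ideal S I"
  shows "almost_canonical_ideal S (normalize_ideal S I)"
proof -
  have rel: "relative_ideal S I" using assms by (simp add: almost_canonical_ideal_def)
  have "relative_ideal S (normalize_ideal S I)"
    unfolding normalize_ideal_def by (rule relative_ideal_translate[OF rel])
  moreover have "normalize_ideal S (normalize_ideal S I) = normalize_ideal S I"
    by (rule normalize_ideal_self[OF frobenius_normalize_ideal[OF rel]])
  ultimately show ?thesis using assms by (simp add: almost_canonical_ideal_def)
qed

section \<open>Almost canonical ideals as the ideals between M + K and K\<close>

lemma colon_between:
  assumes "M + K \<subseteq> I" and "I \<subseteq> K"
  shows "colon I M = K \<union> {F}"
proof
  show "colon I M \<subseteq> K \<union> {F}"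
    using assms(2) unfolding colon_canonical[symmetric] by (auto simp: mem_colon_iff subset_iff)
  have "F + s \<in> I" if "s \<in> M" for s
    using that nonneg[of s] above_frobenius_mem_sum[of "F + s"] assms(1)
    by (force simp: max_ideal_def)
  moreover have "x + s \<in> I" if "x \<in> K" "s \<in> M" for x s
    using that assms(1) set_plus_intro[of s M x K] by (auto simp: add.commute)
  ultimately show "K \<union> {F} \<subseteq> colon I M" by (auto simp: mem_colon_iff)
qed

lemma relative_ideal_between:
  assumes "M + K \<subseteq> I" and "I \<subseteq> K"
  shows "relative_ideal S I"
  unfolding relative_ideal_def
proof (intro conjI)
  show "I \<noteq> {}" using above_frobenius_mem_sum[of "F + 1"] assms(1) by auto
  show "I + S \<subseteq> I"
  proof
    fix z assume "z \<in> I + S"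
    then obtain x s where z: "z = x + s" "x \<in> I" "s \<in> S" by (auto elim: set_plus_elim)
    show "z \<in> I"
    proof (cases "s = 0")
      case False
      then have "s + x \<in> M + K" using z assms(2) by (intro set_plus_intro) (auto simp: max_ideal_def)
      then show ?thesis using z assms(1) by (auto simp: add.commute)
    qed (use z in simp)
  qed
  \<comment> \<open>\<open>K\<close> consists of nonnegative numbers, so translating by \<open>F + 1\<close> moves it beyond \<open>F\<close>.\<close>
  have "(F + 1) +o I \<subseteq> S"
    using assms(2)
    by (auto simp: elt_set_plus_def std_canonical_def int_mem_Nats_iff intro!: above_frobenius)
  then show "\<exists>z\<in>S. z +o I \<subseteq> S" using above_frobenius[of "F + 1"] by auto
qed

lemma almost_canonical_iff_between:
  "almost_canonical_ideal S I \<and> frobenius I = F \<longleftrightarrow> M + K \<subseteq> I \<and> I \<subseteq> K"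
proof (intro iffI conjI)
  assume I: "almost_canonical_ideal S I \<and> frobenius I = F"
  then have rel: "relative_ideal S I" and colon: "colon I M = K \<union> {F}"
    using normalize_ideal_self[of I]
    unfolding almost_canonical_ideal_def by metis+
  have "I \<subseteq> colon I M"
    using relative_ideal_add[OF rel] by (auto simp: mem_colon_iff max_ideal_def)
  moreover have "F \<notin> I" using relative_ideal_frobenius(1)[OF rel] I by simp
  ultimately show "I \<subseteq> K" using colon by auto
  show "M + K \<subseteq> I"
  proof
    fix z assume "z \<in> M + K"
    then obtain s x where "z = s + x" "s \<in> M" "x \<in> K" by (auto elim: set_plus_elim)
    moreover have "x \<in> colon I M" using \<open>x \<in> K\<close> colon by simp
    ultimately show "z \<in> I" by (auto simp: mem_colon_iff add.commute)
  qed
next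
  assume I: "M + K \<subseteq> I \<and> I \<subseteq> K"
  show frob: "frobenius I = F"
    using I above_frobenius_mem_sum frobenius_notin_canonical by (intro frobenius_eqI) auto
  show "almost_canonical_ideal S I"
    using I by (simp add: almost_canonical_ideal_def relative_ideal_between colon_between
        normalize_ideal_self[OF frob])
qed

section \<open>Types and counts\<close>

text \<open>
  The complement of \<open>M + K\<close> in \<open>K\<close>: the elements on which the ideals between \<open>M + K\<close> and \<open>K\<close>
  can differ. It is the set of minimal generators of \<open>K\<close> as a relative ideal.
\<close>
definition canonical_generators :: "int set" where
  "canonical_generators = K - (M + K)"

lemma finite_canonical_generators: "finite canonical_generators"
proof (rule finite_subset)
  show "canonical_generators \<subseteq> {0..F}"
    using above_frobenius_mem_sum
    by (force simp: canonical_generators_def std_canonical_def int_mem_Nats_iff)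
qed simp

text \<open>
  An \<open>x \<in> K\<close> avoids \<open>M + K\<close> iff \<open>x - s \<notin> K\<close> for all \<open>s \<in> M\<close>; by duality this is \<open>(F - x) + s \<in> S\<close> for
  all \<open>s \<in> M\<close>, while \<open>x \<in> K\<close> itself is \<open>F - x \<notin> S\<close>.
\<close>
lemma reflect_canonical_generators:
  "x \<in> canonical_generators \<longleftrightarrow> F - x \<in> colon S M - S"
proof -
  have "x \<in> M + K \<longleftrightarrow> (\<exists>s\<in>M. x - s \<in> K)"
    by (auto simp: set_plus_def intro: bexI[of _ "x - _"])
  then show ?thesis
    by (auto simp: canonical_generators_def mem_canonical_iff mem_colon_iff algebra_simps)
qed

lemma card_canonical_generators: "card canonical_generators = ideal_type S S"
proof -
  have "bij_betw (\<lambda>x. F - x) canonical_generators (colon S M - S)"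
    by (rule bij_betw_byWitness[where f' = "\<lambda>x. F - x"])
       (auto simp: reflect_canonical_generators)
  then show ?thesis
    unfolding ideal_type_def by (rule bij_betw_same_card)
qed

text \<open>
  The type counts the elements of \<open>K \<union> {F}\<close> missing from \<open>I\<close>; the extra one is always \<open>F\<close>.
\<close>
lemma ideal_type_between:
  assumes "M + K \<subseteq> I" and "I \<subseteq> K"
  shows "ideal_type S I = card (K - I) + 1"
proof -
  have "finite (K - I)"
    using assms(1)
    by (intro finite_subset[OF _ finite_canonical_generators])
       (auto simp: canonical_generators_def)
  moreover have "(K \<union> {F}) - I = insert F (K - I)"
    using assms(2) frobenius_notin_canonical by auto
  ultimately show ?thesis
    using assms frobenius_notin_canonical by (simp add: ideal_type_def colon_between)
qed

text \<open>
  Passing to the complement in \<open>K\<close> turns each of the counts into a count of subsets of the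
  \<open>t\<close>-element set \<^const>\<open>canonical_generators\<close>, with the type shifted by one.
\<close>
lemma card_almost_canonical_ideals:
  "card {I. almost_canonical_ideal S I \<and> frobenius I = F \<and> P (ideal_type S I)}
    = card {A. A \<subseteq> canonical_generators \<and> P (card A + 1)}"
proof -
  have mem: "almost_canonical_ideal S I \<and> frobenius I = F \<and> P (ideal_type S I)
      \<longleftrightarrow> M + K \<subseteq> I \<and> I \<subseteq> K \<and> P (card (K - I) + 1)" for I
    using almost_canonical_iff_between[of I] ideal_type_between[of I] by metis
  have invol: "K - (K - A) = A" if "A \<subseteq> K" for A
    using that by blast
  have "bij_betw (\<lambda>I. K - I) {I. M + K \<subseteq> I \<and> I \<subseteq> K \<and> P (card (K - I) + 1)}
      {A. A \<subseteq> canonical_generators \<and> P (card A + 1)}"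
    using sum_subset_canonical
    by (intro bij_betw_byWitness[where f' = "\<lambda>A. K - A"])
       (auto simp: canonical_generators_def invol subset_iff intro: arg_cong[where f = P])
  then show ?thesis
    unfolding mem by (rule bij_betw_same_card)
qed

lemma ideal_type_le:
  assumes "almost_canonical_ideal S I"
  shows "ideal_type S I \<le> ideal_type S S + 1"
proof -
  let ?J = "normalize_ideal S I"
  have "relative_ideal S I" using assms by (simp add: almost_canonical_ideal_def)
  then have J: "M + K \<subseteq> ?J" "?J \<subseteq> K"
    using almost_canonical_iff_between[of ?J] almost_canonical_normalize_ideal[OF assms]
    by (auto simp: frobenius_normalize_ideal)
  have "K - ?J \<subseteq> canonical_generators" using J by (auto simp: canonical_generators_def)
  then have "card (K - ?J) \<le> ideal_type S S"
    unfolding card_canonical_generators[symmetric]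
    by (rule card_mono[OF finite_canonical_generators])
  moreover have "ideal_type S I = ideal_type S ?J"
    by (simp add: normalize_ideal_def ideal_type_translate)
  ultimately show ?thesis using ideal_type_between[OF J] by simp
qed

end

theorem corollary2p6:
  fixes S :: "int set" and t :: nat
  assumes "numerical_semigroup S"
    and "S \<noteq> \<nat>"
    and "t = ideal_type S S"
  shows "(\<forall>I. almost_canonical_ideal S I \<longrightarrow> ideal_type S I \<le> t + 1) \<and>
    (\<forall>i::nat. 1 \<le> i \<and> i \<le> t + 1 \<longrightarrow>
      card {I. almost_canonical_ideal S I \<and> frobenius I = frobenius S \<and> ideal_type S I = i}
        = t choose (i - 1)) \<and>
    card {I. almost_canonical_ideal S I \<and> frobenius I = frobenius S} = 2 ^ t"
proof -
  interpret proper_numerical_semigroup S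
    using assms(1,2) by unfold_locales
  have t: "card canonical_generators = t"
    using card_canonical_generators assms(3) by simp
  have "card {I. almost_canonical_ideal S I \<and> frobenius I = F \<and> ideal_type S I = i}
      = t choose (i - 1)" if "1 \<le> i" for i
  proof -
    have "{A. A \<subseteq> canonical_generators \<and> card A + 1 = i}
        = {A. A \<subseteq> canonical_generators \<and> card A = i - 1}"
      using that by auto
    then show ?thesis
      using card_almost_canonical_ideals[of "\<lambda>n. n = i"]
        n_subsets[OF finite_canonical_generators, of "i - 1"] t by simp
  qed
  moreover have "card {I. almost_canonical_ideal S I \<and> frobenius I = F} = 2 ^ t"
    using card_almost_canonical_ideals[of "\<lambda>_. True"]
      card_Pow[OF finite_canonical_generators] t by (simp add: Pow_def)
  ultimately show ?thesis
    using ideal_type_le assms(3) by simp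
qed

end
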